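(* Let $d\ge 2$. For every velocity vector $\mathbf{n}\in\mathbb{Z}_{>0}^d$, \[ \min_{\mathbf{w} \in \operatorname{int}(Z(\mathbf{n})) \cap \mathbb{Z}^d} \operatorname{ca}(Z(\mathbf{n}),\mathbf{w}) = \frac{1}{\operatorname{gap}(\mathbf{n})} - 1 . \] Consequently, the following two statements are equivalent: (a) (Lonely Runner Conjecture) for every velocity vector $\mathbf{n}\in\mathbb{Z}_{>0}^d$ one has $\operatorname{gap}(\mathbf{n})\ge\frac1{d+1}$; (b) for every velocity vector $\mathbf{n}\in\mathbb{Z}_{>0}^d$ there exists an interior lattice point $\mathbf{w}\in\operatorname{int}(Z(\mathbf{n}))\cap\mathbb{Z}^d$ such that $\operatorname{ca}(Z(\mathbf{n}),\mathbf{w})\le d$.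
   Context: A velocity vector is a vector $\mathbf{n}=(n_1,\dots,n_d)\in\mathbb{Z}_{>0}^d$, $d\ge2$, whose entries are pairwise distinct and relatively prime (i.e. $\gcd(n_1,\dots,n_d)=1$). Its gap of loneliness is $\operatorname{gap}(\mathbf{n}) := \max_{\beta\in\mathbb{R}}\min_{1\le i\le d}\|\beta n_i\|_{\mathbb{Z}}$, where $\|x\|_{\mathbb{Z}}$ is the distance from $x$ to the nearest integer (the maximum is attained). The lonely runner zonohedron is $Z(\mathbf{n}) := \mathbb{R}\mathbf{n}+[0,1]^d$ (Minkowski sum). For a closed convex set $C\subseteq\mathbb{R}^d$ (possibly unbounded) and $\mathbf{w}\in\operatorname{int}(C)$, the coefficient of asymmetry is $\operatorname{ca}(C,\mathbf{w}) := \min\{\lambda\ge1 : \mathbf{w}-C\subseteq\lambda(C-\mathbf{w})\}$. *)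

theory Defs
  imports "HOL-Analysis.Analysis"
begin

definition velocity_vector :: "int ^ 'd \<Rightarrow> bool" where
  "velocity_vector n \<longleftrightarrow>
     (\<forall>i. 0 < n $ i) \<and> inj (\<lambda>i. n $ i) \<and> Gcd (range (\<lambda>i. n $ i)) = 1"

definition dist_to_int :: "real \<Rightarrow> real" where
  "dist_to_int x = infdist x \<int>"

(* Greatest (here) and Least (in ca) denote genuine maxima and minima: for a set of reals
   without a greatest (least) element they are unspecified, unlike Sup and Inf. *)
definition gap :: "int ^ 'd \<Rightarrow> real" where
  "gap n = (GREATEST g. \<exists>\<beta>::real. g = Min (range (\<lambda>i. dist_to_int (\<beta> * real_of_int (n $ i)))))"

(* + is the Minkowski sum of sets from HOL-Library.Set_Algebras; cbox 0 1 is the unit cube *)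
definition lr_zonohedron :: "int ^ 'd \<Rightarrow> (real ^ 'd) set" where
  "lr_zonohedron n = range (\<lambda>t::real. t *\<^sub>R (\<chi> i. real_of_int (n $ i))) + cbox 0 1"

(* the sets w - C and l (C - w) are images, since - on sets is set difference *)
definition ca :: "'a::euclidean_space set \<Rightarrow> 'a \<Rightarrow> real" where
  "ca C w = (LEAST l. 1 \<le> l \<and> (\<lambda>x. w - x) ` C \<subseteq> (\<lambda>x. l *\<^sub>R (x - w)) ` C)"

definition integer_lattice :: "(real ^ 'd) set" where
  "integer_lattice = {w. \<forall>i. w $ i \<in> \<int>}"

end

theory Submission
  imports Defs
begin

text \<open>
  The zonohedron \<open>Z = \<real>n + [0,1]\<^sup>d\<close> consists of the points \<open>x\<close> for which some \<open>t\<close> brings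
  \<open>x - t n\<close> within sup-distance \<open>1/2\<close> of the centre \<open>(1/2, ..., 1/2)\<close> of the cube.  Shrinking the
  cube about its centre by \<open>g\<close> on every side gives the eroded zonohedra \<open>Z\<^sub>g\<close>, which decrease from
  \<open>Z\<^sub>0 = Z\<close> as \<open>g\<close> grows.  The \<^emph>\<open>depth\<close> of a point is the greatest \<open>g\<close> with \<open>x \<in> Z\<^sub>g\<close>; the interior
  points are those of positive depth.  Two facts about depth give the result.

  First, a point \<open>w\<close> of depth \<open>g > 0\<close> satisfies \<open>ca Z w = 1/g - 1\<close>
  (\<open>ca_lr_zonohedron_eq\<close>): \<open>Z\<close> is the unit ball of a seminorm about its centre, \<open>w\<close> has seminorm
  \<open>1 - 2 g\<close>, and a point at seminorm \<open>r\<close> divides the chord through it and the centre in the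
  ratio \<open>(1 + r) : (1 - r)\<close>.

  Secondly, \<open>gap n\<close> is the greatest depth of a lattice point (\<open>lattice_depth_le_gap\<close>,
  \<open>gap_attained\<close>).  Indeed, in one coordinate, \<open>x\<close> has distance to the nearest integer
  equal to the best depth \<open>1/2 - \<bar>w - 1/2 - x\<bar>\<close> of \<open>x\<close> in a unit interval \<open>[w - 1, w]\<close> with integer
  \<open>w\<close>; since the integers \<open>w\<^sub>i\<close> can be chosen independently in each coordinate for a common time
  \<open>\<beta>\<close>, maximising over \<open>\<beta>\<close> and \<open>w\<close> yields both quantities.

  As \<open>1/g - 1\<close> decreases in \<open>g\<close>, the least asymmetry over lattice points is \<open>1 / gap n - 1\<close>, and it
  is at most \<open>d\<close> exactly when \<open>gap n \<ge> 1/(d + 1)\<close>.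
\<close>

section \<open>Eroded zonohedra and depth\<close>

definition eroded_zonohedron :: "real \<Rightarrow> int ^ 'd \<Rightarrow> (real ^ 'd) set" where
  "eroded_zonohedron g n = {x. \<exists>t. \<forall>i. \<bar>x $ i - 1/2 - t * real_of_int (n $ i)\<bar> \<le> 1/2 - g}"

definition has_depth :: "int ^ 'd \<Rightarrow> real ^ 'd \<Rightarrow> real \<Rightarrow> bool" where
  "has_depth n x g \<longleftrightarrow> x \<in> eroded_zonohedron g n \<and> (\<forall>h. x \<in> eroded_zonohedron h n \<longrightarrow> h \<le> g)"

lemma lr_zonohedron_eq_eroded: "lr_zonohedron n = eroded_zonohedron 0 n"
proof (intro set_eqI iffI)
  fix x :: "real ^ 'a"
  assume "x \<in> lr_zonohedron n"
  then obtain t p where x: "x = t *\<^sub>R (\<chi> i. real_of_int (n $ i)) + p" and p: "p \<in> cbox 0 1"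
    unfolding lr_zonohedron_def by (auto elim!: set_plus_elim)
  have "\<bar>x $ i - 1/2 - t * real_of_int (n $ i)\<bar> \<le> 1/2 - 0" for i
  proof -
    have "0 \<le> p $ i \<and> p $ i \<le> 1"
      using p by (simp add: mem_box_cart)
    then show ?thesis
      unfolding x by (simp add: abs_if)
  qed
  then show "x \<in> eroded_zonohedron 0 n"
    unfolding eroded_zonohedron_def by blast
next
  fix x :: "real ^ 'a"
  assume "x \<in> eroded_zonohedron 0 n"
  then obtain t where t: "\<And>i. \<bar>x $ i - 1/2 - t * real_of_int (n $ i)\<bar> \<le> 1/2 - 0"
    unfolding eroded_zonohedron_def by blast
  let ?l = "t *\<^sub>R (\<chi> i. real_of_int (n $ i))"
  have "0 \<le> (x - ?l) $ i \<and> (x - ?l) $ i \<le> 1" for i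
    using t[of i] by (simp add: abs_if split: if_splits)
  then have "x - ?l \<in> cbox 0 1"
    by (simp add: mem_box_cart)
  then have "?l + (x - ?l) \<in> lr_zonohedron n"
    unfolding lr_zonohedron_def by (intro set_plus_intro) auto
  then show "x \<in> lr_zonohedron n"
    by simp
qed

lemma eroded_zonohedron_le_half:
  assumes "x \<in> eroded_zonohedron g n"
  shows "g \<le> 1/2"
proof -
  obtain t where "\<And>i. \<bar>x $ i - 1/2 - t * real_of_int (n $ i)\<bar> \<le> 1/2 - g"
    using assms unfolding eroded_zonohedron_def by blast
  from order_trans[OF abs_ge_zero this] show ?thesis
    by simp
qed

lemma interior_lr_zonohedron:
  "interior (lr_zonohedron n) = (\<Union>g\<in>{0<..}. eroded_zonohedron g n)"
proof (intro set_eqI iffI)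
  fix x :: "real ^ 'a"
  assume "x \<in> interior (lr_zonohedron n)"
  then obtain e where e: "e > 0" "cball x e \<subseteq> lr_zonohedron n"
    using mem_interior_cball by blast
  \<comment> \<open>Pushing \<open>x\<close> away from the centre and scaling back turns room around \<open>x\<close> into depth.\<close>
  define c :: "real ^ 'a" where "c = (\<chi> i. 1/2)"
  define d where "d = e / (norm (x - c) + 1)"
  have d: "d > 0"
    unfolding d_def using e(1) by (intro divide_pos_pos add_nonneg_pos) auto
  have "norm (d *\<^sub>R (x - c)) \<le> d * (norm (x - c) + 1)"
    using d by (simp add: mult_left_mono)
  also have "\<dots> = e"
  proof -
    have "norm (x - c) + 1 \<noteq> 0"
      using norm_ge_zero[of "x - c"] by linarith
    then show ?thesis by (simp add: d_def)
  qed
  finally have "x + d *\<^sub>R (x - c) \<in> cball x e"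
    by (simp add: dist_norm)
  then have "x + d *\<^sub>R (x - c) \<in> eroded_zonohedron 0 n"
    using e(2) by (auto simp: lr_zonohedron_eq_eroded)
  then obtain t where t: "\<And>i. \<bar>(x + d *\<^sub>R (x - c)) $ i - 1/2 - t * real_of_int (n $ i)\<bar> \<le> 1/2 - 0"
    unfolding eroded_zonohedron_def by blast
  have "\<bar>x $ i - 1/2 - (t / (1 + d)) * real_of_int (n $ i)\<bar> \<le> 1/2 - (1/2 - 1 / (2 * (1 + d)))" for i
  proof -
    have "x $ i - 1/2 - (t / (1 + d)) * real_of_int (n $ i)
        = ((x + d *\<^sub>R (x - c)) $ i - 1/2 - t * real_of_int (n $ i)) / (1 + d)"
      using d by (simp add: c_def field_simps)
    then have "\<bar>x $ i - 1/2 - (t / (1 + d)) * real_of_int (n $ i)\<bar>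
        = \<bar>(x + d *\<^sub>R (x - c)) $ i - 1/2 - t * real_of_int (n $ i)\<bar> / (1 + d)"
      using d by (simp add: abs_divide)
    also have "\<dots> \<le> (1/2) / (1 + d)"
      using t[of i] d by (intro divide_right_mono) auto
    finally show ?thesis
      by simp
  qed
  then have "x \<in> eroded_zonohedron (1/2 - 1 / (2 * (1 + d))) n"
    unfolding eroded_zonohedron_def by blast
  moreover have "1/2 - 1 / (2 * (1 + d)) > 0"
    using d by (simp add: field_simps)
  ultimately show "x \<in> (\<Union>g\<in>{0<..}. eroded_zonohedron g n)"
    by blast
next
  fix x :: "real ^ 'a"
  assume "x \<in> (\<Union>g\<in>{0<..}. eroded_zonohedron g n)"
  then obtain g t where g: "g > 0"
    and t: "\<And>i. \<bar>x $ i - 1/2 - t * real_of_int (n $ i)\<bar> \<le> 1/2 - g"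
    unfolding eroded_zonohedron_def by blast
  have "cball x g \<subseteq> lr_zonohedron n"
  proof
    fix y assume "y \<in> cball x g"
    then have y: "\<bar>x $ i - y $ i\<bar> \<le> g" for i
      using component_le_norm_cart[of "x - y" i] by (simp add: dist_norm)
    have "\<bar>y $ i - 1/2 - t * real_of_int (n $ i)\<bar> \<le> 1/2 - 0" for i
      using t[of i] y[of i] by linarith
    then show "y \<in> lr_zonohedron n"
      unfolding lr_zonohedron_eq_eroded eroded_zonohedron_def by blast
  qed
  then show "x \<in> interior (lr_zonohedron n)"
    using g mem_interior_cball by blast
qed

lemma continuous_on_Min_image:
  fixes f :: "'i \<Rightarrow> 'a::topological_space \<Rightarrow> real"
  assumes "finite I" "I \<noteq> {}" and "\<And>i. i \<in> I \<Longrightarrow> continuous_on S (f i)"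
  shows "continuous_on S (\<lambda>x. Min ((\<lambda>i. f i x) ` I))"
  using assms by (induction I rule: finite_ne_induct) (auto intro!: continuous_on_min)

text \<open>
  The depth along the line is a continuous function of the time \<open>t\<close> that tends to \<open>-\<infinity>\<close>, because the
  speeds are positive; so its supremum is attained on a compact interval.
\<close>
lemma ex_has_depth:
  fixes n :: "int ^ 'd::finite"
  assumes pos: "\<And>i. 0 < n $ i"
  shows "\<exists>g. has_depth n x g"
proof -
  define f where "f t = Min (range (\<lambda>i. 1/2 - \<bar>x $ i - 1/2 - t * real_of_int (n $ i)\<bar>))" for t
  have mem: "x \<in> eroded_zonohedron g n \<longleftrightarrow> (\<exists>t. g \<le> f t)" for g
    unfolding eroded_zonohedron_def f_def by (auto simp: algebra_simps)
  have f_le: "f t \<le> 1/2 - \<bar>x $ i - 1/2 - t * real_of_int (n $ i)\<bar>" for t i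
    unfolding f_def by (rule Min_le) auto
  have cont: "continuous_on S f" for S
    unfolding f_def by (intro continuous_on_Min_image continuous_intros) auto
  fix j :: 'd
  define B where "B = \<bar>x $ j - 1/2\<bar> + 1/2 - f 0"
  have B: "B \<ge> 0"
    using f_le[of 0 j] by (simp add: B_def)
  have "\<exists>s\<in>{-B..B}. \<forall>t\<in>{-B..B}. f t \<le> f s"
    using B by (intro continuous_attains_sup cont) auto
  then obtain s where s: "\<And>t. t \<in> {-B..B} \<Longrightarrow> f t \<le> f s"
    by blast
  have "f t \<le> f s" for t
  proof (cases "\<bar>t\<bar> \<le> B")
    case True
    then show ?thesis by (intro s) auto
  next
    case False
    have "\<bar>t\<bar> * 1 \<le> \<bar>t\<bar> * real_of_int (n $ j)"
      using pos[of j] by (intro mult_left_mono) (auto simp: int_one_le_iff_zero_less)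
    also have "\<dots> = \<bar>t * real_of_int (n $ j)\<bar>"
      using pos[of j] by (simp add: abs_mult)
    finally have "f t \<le> f 0"
      using False f_le[of t j] unfolding B_def by linarith
    then show ?thesis
      using s[of 0] B by auto
  qed
  then have "has_depth n x (f s)"
    unfolding has_depth_def mem by (meson order_refl order_trans)
  then show ?thesis ..
qed

lemma interior_lr_zonohedron_depth:
  assumes "x \<in> interior (lr_zonohedron n)" and "has_depth n x g"
  shows "0 < g"
  using assms unfolding interior_lr_zonohedron has_depth_def by force

section \<open>Asymmetry in terms of depth\<close>

text \<open>
  The inclusion holds because the reflected point \<open>w + (w - x)/l\<close> has coordinates
  \<open>q + (q - p)/l\<close> modulo the line, where \<open>q \<in> [g, 1 - g]\<close> and \<open>p \<in> [0, 1]\<close>; for \<open>l = (1 - g)/g\<close> this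
  ranges exactly over \<open>[0, 1]\<close>.
\<close>
lemma reflection_subset_of_depth:
  assumes g: "0 < g" and w: "w \<in> eroded_zonohedron g n"
  shows "(\<lambda>x. w - x) ` lr_zonohedron n \<subseteq> (\<lambda>x. (1 / g - 1) *\<^sub>R (x - w)) ` lr_zonohedron n"
proof (rule image_subsetI)
  fix x assume "x \<in> lr_zonohedron n"
  then obtain s where s: "\<And>i. \<bar>x $ i - 1/2 - s * real_of_int (n $ i)\<bar> \<le> 1/2"
    unfolding lr_zonohedron_eq_eroded eroded_zonohedron_def by auto
  obtain t where t: "\<And>i. \<bar>w $ i - 1/2 - t * real_of_int (n $ i)\<bar> \<le> 1/2 - g"
    using w unfolding eroded_zonohedron_def by auto
  have g2: "g \<le> 1/2"
    using w by (rule eroded_zonohedron_le_half)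
  define m where "m = g / (1 - g)"
  have m: "0 \<le> m" "(1 / g - 1) * m = 1" "m * (1 - g) = g"
    using g g2 by (auto simp: m_def divide_simps)
  define y where "y = w + m *\<^sub>R (w - x)"
  have "\<bar>y $ i - 1/2 - (t + m * (t - s)) * real_of_int (n $ i)\<bar> \<le> 1/2 - 0" for i
  proof -
    let ?a = "w $ i - 1/2 - t * real_of_int (n $ i)" and ?b = "x $ i - 1/2 - s * real_of_int (n $ i)"
    have "y $ i - 1/2 - (t + m * (t - s)) * real_of_int (n $ i) = (1 + m) * ?a - m * ?b"
      by (simp add: y_def algebra_simps)
    then have "\<bar>y $ i - 1/2 - (t + m * (t - s)) * real_of_int (n $ i)\<bar> \<le> (1 + m) * \<bar>?a\<bar> + m * \<bar>?b\<bar>"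
      using m(1) abs_triangle_ineq4[of "(1 + m) * ?a" "m * ?b"] by (simp add: abs_mult)
    also have "\<dots> \<le> (1 + m) * (1/2 - g) + m * (1/2)"
      using m(1) s t by (intro add_mono mult_left_mono) auto
    also have "\<dots> = 1/2 - g + m * (1 - g)"
      by (simp add: field_simps)
    finally show ?thesis
      using m(3) by simp
  qed
  then have "y \<in> lr_zonohedron n"
    unfolding lr_zonohedron_eq_eroded eroded_zonohedron_def by blast
  moreover have "w - x = (1 / g - 1) *\<^sub>R (y - w)"
    using m(2) by (simp add: y_def)
  ultimately show "w - x \<in> (\<lambda>x. (1 / g - 1) *\<^sub>R (x - w)) ` lr_zonohedron n"
    by blast
qed

text \<open>
  Testing the inclusion on the boundary point opposite to \<open>w\<close> through the centre suffices: its
  reflection bounds the seminorm \<open>r\<close> of \<open>w\<close>, which minimality of \<open>r\<close> turns into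
  \<open>l \<ge> (1 + r)/(1 - r)\<close>.  For \<open>r = 0\<close> no such point exists, but the bound is then \<open>l \<ge> 1\<close>.
\<close>
lemma reflection_subset_imp_ge:
  assumes depth: "has_depth n w g" and g: "0 < g" and l: "1 \<le> l"
    and sub: "(\<lambda>x. w - x) ` lr_zonohedron n \<subseteq> (\<lambda>x. l *\<^sub>R (x - w)) ` lr_zonohedron n"
  shows "1 / g - 1 \<le> l"
proof (cases "g = 1/2")
  case True
  then show ?thesis using l by (simp only:) simp
next
  case False
  have w: "w \<in> eroded_zonohedron g n"
    and max: "\<And>h. w \<in> eroded_zonohedron h n \<Longrightarrow> h \<le> g"
    using depth by (auto simp: has_depth_def)
  \<comment> \<open>\<open>\<nu> = r/2\<close>, and \<open>x\<close> below is the test point: \<open>w\<close> scaled about the centre by \<open>-1/r\<close>.\<close>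
  define \<nu> where "\<nu> = 1/2 - g"
  have \<nu>: "\<nu> > 0"
    using False eroded_zonohedron_le_half[OF w] by (simp add: \<nu>_def)
  obtain t where t: "\<And>i. \<bar>w $ i - 1/2 - t * real_of_int (n $ i)\<bar> \<le> \<nu>"
    using w unfolding eroded_zonohedron_def \<nu>_def by auto
  define k where "k = 1 / (2 * \<nu>)"
  have k: "k > 0" "k * \<nu> = 1/2"
    using \<nu> by (auto simp: k_def)
  define x :: "real ^ 'a" where "x = (\<chi> i. 1/2 - k * (w $ i - 1/2))"
  have "\<bar>x $ i - 1/2 - (- k * t) * real_of_int (n $ i)\<bar> \<le> 1/2 - 0" for i
  proof -
    have "x $ i - 1/2 - (- k * t) * real_of_int (n $ i)
        = - (k * (w $ i - 1/2 - t * real_of_int (n $ i)))"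
      by (simp add: x_def algebra_simps)
    then have "\<bar>x $ i - 1/2 - (- k * t) * real_of_int (n $ i)\<bar>
        = k * \<bar>w $ i - 1/2 - t * real_of_int (n $ i)\<bar>"
      using k(1) by (simp add: abs_mult)
    also have "\<dots> \<le> k * \<nu>"
      using t k(1) by (intro mult_left_mono) auto
    finally show ?thesis
      using k(2) by simp
  qed
  then have "x \<in> lr_zonohedron n"
    unfolding lr_zonohedron_eq_eroded eroded_zonohedron_def by blast
  then obtain y where y: "y \<in> lr_zonohedron n" and wx: "w - x = l *\<^sub>R (y - w)"
    using sub by blast
  obtain s where s: "\<And>i. \<bar>y $ i - 1/2 - s * real_of_int (n $ i)\<bar> \<le> 1/2"
    using y unfolding lr_zonohedron_eq_eroded eroded_zonohedron_def by auto
  define D where "D = 1 + k + l"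
  have D: "D > 0"
    using k(1) l by (simp add: D_def)
  have "\<bar>w $ i - 1/2 - (l * s / D) * real_of_int (n $ i)\<bar> \<le> 1/2 - (1/2 - l / (2 * D))" for i
  proof -
    have "w $ i - x $ i = l * (y $ i - w $ i)"
      using arg_cong[OF wx, of "\<lambda>v. v $ i"] by simp
    then have "D * (w $ i - 1/2) = l * (y $ i - 1/2)"
      by (simp add: x_def D_def algebra_simps)
    then have "w $ i - 1/2 = l * (y $ i - 1/2) / D"
      using D by (simp add: field_simps)
    then have "w $ i - 1/2 - (l * s / D) * real_of_int (n $ i)
        = (l / D) * (y $ i - 1/2 - s * real_of_int (n $ i))"
      by (simp add: algebra_simps diff_divide_distrib)
    then have "\<bar>w $ i - 1/2 - (l * s / D) * real_of_int (n $ i)\<bar>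
        = (l / D) * \<bar>y $ i - 1/2 - s * real_of_int (n $ i)\<bar>"
      using l D by (simp add: abs_mult)
    also have "\<dots> \<le> (l / D) * (1/2)"
      using s l D by (intro mult_left_mono) auto
    finally show ?thesis
      by simp
  qed
  then have "w \<in> eroded_zonohedron (1/2 - l / (2 * D)) n"
    unfolding eroded_zonohedron_def by blast
  then have "\<nu> \<le> l / (2 * D)"
    using max by (force simp: \<nu>_def)
  then have "2 * (\<nu> * D) \<le> l"
    using D by (simp add: field_simps)
  then have "2 * \<nu> + 1 + 2 * \<nu> * l \<le> l"
    using k(2) by (simp add: D_def algebra_simps)
  then show ?thesis
    using g by (simp add: \<nu>_def field_simps)
qed

lemma ca_lr_zonohedron_eq:
  assumes depth: "has_depth n w g" and g: "0 < g"
  shows "ca (lr_zonohedron n) w = 1 / g - 1"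
  unfolding ca_def
proof (rule Least_equality)
  have w: "w \<in> eroded_zonohedron g n"
    using depth by (simp add: has_depth_def)
  have "1 \<le> 1 / g - 1"
    using eroded_zonohedron_le_half[OF w] g by (simp add: field_simps)
  then show "1 \<le> 1 / g - 1 \<and>
    (\<lambda>x. w - x) ` lr_zonohedron n \<subseteq> (\<lambda>x. (1 / g - 1) *\<^sub>R (x - w)) ` lr_zonohedron n"
    using reflection_subset_of_depth[OF g w] by blast
qed (use reflection_subset_imp_ge[OF depth g] in blast)

section \<open>The gap as the greatest depth of a lattice point\<close>

lemma dist_to_int_le: "k \<in> \<int> \<Longrightarrow> dist_to_int x \<le> \<bar>x - k\<bar>"
  unfolding dist_to_int_def using infdist_le[of k \<int> x] by (simp add: dist_real_def)

text \<open>
  The bound expresses that the integers nearest to a point of \<open>[w - 1, w]\<close> are the endpoints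
  \<open>w - 1\<close> and \<open>w\<close>; for a point outside this interval the left-hand side is negative.
\<close>
lemma interval_depth_le_dist_to_int:
  assumes "w \<in> \<int>"
  shows "1/2 - \<bar>w - 1/2 - x\<bar> \<le> dist_to_int x"
proof -
  have "1/2 - \<bar>w - 1/2 - x\<bar> \<le> dist x k" if k: "k \<in> \<int>" for k
  proof -
    obtain a where a: "w = real_of_int a"
      using assms by (rule Ints_cases)
    obtain b where b: "k = real_of_int b"
      using k by (rule Ints_cases)
    consider "a \<le> b" | "b \<le> a - 1"
      by linarith
    then have "w \<le> k \<or> k \<le> w - 1"
      by cases (auto simp: a b)
    then show ?thesis
      unfolding dist_real_def by linarith
  qed
  moreover have "(\<int> :: real set) \<noteq> {}"
    using Ints_0 by blast
  ultimately show ?thesis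
    unfolding dist_to_int_def by (auto simp: infdist_notempty intro!: cINF_greatest)
qed

lemma dist_to_int_le_interval_depth:
  "dist_to_int x \<le> 1/2 - \<bar>(of_int \<lfloor>x\<rfloor> + 1) - 1/2 - x\<bar>"
proof -
  have "dist_to_int x \<le> \<bar>x - of_int \<lfloor>x\<rfloor>\<bar>" "dist_to_int x \<le> \<bar>x - (of_int \<lfloor>x\<rfloor> + 1)\<bar>"
    by (intro dist_to_int_le Ints_add Ints_of_int Ints_1)+
  moreover have "of_int \<lfloor>x\<rfloor> \<le> x" "x < of_int \<lfloor>x\<rfloor> + 1"
    by linarith+
  ultimately show ?thesis
    by linarith
qed

lemma dist_to_int_add_int:
  assumes "k \<in> \<int>"
  shows "dist_to_int (x + k) = dist_to_int x"
proof -
  have le: "dist_to_int (y + j) \<le> dist_to_int y" if "j \<in> \<int>" for y j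
  proof -
    have "dist_to_int y \<ge> 1/2 - \<bar>(of_int \<lfloor>y + j\<rfloor> + 1 - j) - 1/2 - y\<bar>"
      using that by (intro interval_depth_le_dist_to_int) auto
    moreover have "dist_to_int (y + j) \<le> 1/2 - \<bar>(of_int \<lfloor>y + j\<rfloor> + 1) - 1/2 - (y + j)\<bar>"
      by (rule dist_to_int_le_interval_depth)
    ultimately show ?thesis
      by (simp add: algebra_simps)
  qed
  show ?thesis
    using le[OF assms, of x] le[of "-k" "x + k"] assms by (simp add: Ints_minus)
qed

text \<open>The runners are back at the start at time 1, so times in \<open>[0, 1]\<close> suffice for the maximum.\<close>
lemma gap_is_greatest:
  fixes n :: "int ^ 'd::finite"
  shows "\<exists>\<beta>. gap n = Min (range (\<lambda>i. dist_to_int (\<beta> * real_of_int (n $ i))))"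
    and "Min (range (\<lambda>i. dist_to_int (\<beta> * real_of_int (n $ i)))) \<le> gap n"
proof -
  define m where "m \<beta> = Min (range (\<lambda>i. dist_to_int (\<beta> * real_of_int (n $ i))))" for \<beta>
  have cont: "continuous_on {0..1} m"
    unfolding m_def dist_to_int_def
    by (intro continuous_on_Min_image continuous_on_infdist continuous_intros) auto
  have "\<exists>s\<in>{0..1}. \<forall>t\<in>{0..1}. m t \<le> m s"
    by (intro continuous_attains_sup cont) auto
  then obtain s where s: "\<And>t. t \<in> {0..1} \<Longrightarrow> m t \<le> m s"
    by blast
  have le: "m t \<le> m s" for t
  proof -
    have "m (frac t) = m t"
    proof -
      have "frac t * of_int (n $ i) = t * of_int (n $ i) + (- of_int (\<lfloor>t\<rfloor> * n $ i))" for i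
        by (simp add: frac_def algebra_simps)
      then have "dist_to_int (frac t * of_int (n $ i)) = dist_to_int (t * of_int (n $ i))" for i
        by (metis dist_to_int_add_int Ints_minus Ints_of_int)
      then show ?thesis
        by (simp add: m_def)
    qed
    moreover have "frac t \<in> {0..1}"
      using frac_lt_1[of t] by simp
    ultimately show ?thesis
      using s by metis
  qed
  have "gap n = m s"
    unfolding gap_def m_def[symmetric] by (rule Greatest_equality) (use le in auto)
  then show "\<exists>\<beta>. gap n = Min (range (\<lambda>i. dist_to_int (\<beta> * real_of_int (n $ i))))"
    and "Min (range (\<lambda>i. dist_to_int (\<beta> * real_of_int (n $ i)))) \<le> gap n"
    using le[of \<beta>] unfolding m_def by auto
qed

lemma lattice_depth_le_gap:
  fixes n :: "int ^ 'd::finite"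
  assumes w: "w \<in> integer_lattice" and depth: "w \<in> eroded_zonohedron g n"
  shows "g \<le> gap n"
proof -
  obtain t where t: "\<And>i. \<bar>w $ i - 1/2 - t * real_of_int (n $ i)\<bar> \<le> 1/2 - g"
    using depth unfolding eroded_zonohedron_def by auto
  have "g \<le> dist_to_int (t * real_of_int (n $ i))" for i
    using interval_depth_le_dist_to_int[of "w $ i" "t * real_of_int (n $ i)"] w t[of i]
    by (simp add: integer_lattice_def)
  then have "g \<le> Min (range (\<lambda>i. dist_to_int (t * real_of_int (n $ i))))"
    by simp
  also have "\<dots> \<le> gap n"
    by (rule gap_is_greatest)
  finally show ?thesis .
qed

lemma gap_attained:
  fixes n :: "int ^ 'd::finite"
  obtains w where "w \<in> integer_lattice" and "has_depth n w (gap n)"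
proof -
  obtain \<beta> where \<beta>: "gap n = Min (range (\<lambda>i. dist_to_int (\<beta> * real_of_int (n $ i))))"
    using gap_is_greatest(1)[of n] by auto
  define w :: "real ^ 'd" where "w = (\<chi> i. of_int \<lfloor>\<beta> * real_of_int (n $ i)\<rfloor> + 1)"
  have w: "w \<in> integer_lattice"
    by (simp add: w_def integer_lattice_def)
  have "\<bar>w $ i - 1/2 - \<beta> * real_of_int (n $ i)\<bar> \<le> 1/2 - gap n" for i
  proof -
    have "gap n \<le> dist_to_int (\<beta> * real_of_int (n $ i))"
      unfolding \<beta> by (rule Min_le) auto
    also have "\<dots> \<le> 1/2 - \<bar>w $ i - 1/2 - \<beta> * real_of_int (n $ i)\<bar>"
      using dist_to_int_le_interval_depth by (simp add: w_def)
    finally show ?thesis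
      by simp
  qed
  then have "w \<in> eroded_zonohedron (gap n) n"
    unfolding eroded_zonohedron_def by blast
  then show thesis
    using that w lattice_depth_le_gap[OF w] unfolding has_depth_def by blast
qed

text \<open>
  Shortly after the start no runner has gone further than half a lap, and each, having speed at
  least 1, has gone at least the elapsed time.
\<close>
lemma gap_pos:
  fixes n :: "int ^ 'd::finite"
  assumes pos: "\<And>i. 0 < n $ i"
  shows "0 < gap n"
proof -
  define M where "M = real_of_int (Max (range (\<lambda>i. n $ i)))"
  have M: "real_of_int (n $ i) \<le> M" for i
    unfolding M_def by (intro of_int_le_iff[THEN iffD2] Max_ge) auto
  have n1: "1 \<le> real_of_int (n $ i)" for i
    using pos[of i] by linarith
  have M1: "1 \<le> M"
    using order_trans[OF n1 M] .
  define b where "b = 1 / (2 * M)"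
  have b: "0 < b" "b * M = 1/2"
    using M1 by (auto simp: b_def)
  have "\<bar>(1 :: real ^ 'd) $ i - 1/2 - b * real_of_int (n $ i)\<bar> \<le> 1/2 - b" for i
  proof -
    have "b * 1 \<le> b * real_of_int (n $ i)" "b * real_of_int (n $ i) \<le> b * M"
      using n1 M b(1) by (auto intro!: mult_left_mono)
    then show ?thesis
      using b(2) by (simp add: abs_le_iff)
  qed
  then have "1 \<in> eroded_zonohedron b n"
    unfolding eroded_zonohedron_def by blast
  then have "b \<le> gap n"
    by (rule lattice_depth_le_gap[rotated]) (simp add: integer_lattice_def)
  with b show ?thesis
    by simp
qed

section \<open>The least asymmetry over interior lattice points\<close>

lemma least_lattice_asymmetry:
  fixes n :: "int ^ 'd::finite"
  assumes pos: "\<And>i. 0 < n $ i"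
  shows "\<exists>w \<in> interior (lr_zonohedron n) \<inter> integer_lattice.
           ca (lr_zonohedron n) w = 1 / gap n - 1" (is ?attained)
    and "\<forall>w \<in> interior (lr_zonohedron n) \<inter> integer_lattice.
           1 / gap n - 1 \<le> ca (lr_zonohedron n) w" (is ?bound)
proof -
  obtain w where w: "w \<in> integer_lattice" and depth: "has_depth n w (gap n)"
    by (rule gap_attained)
  have "w \<in> interior (lr_zonohedron n)"
    using gap_pos[OF pos] depth unfolding interior_lr_zonohedron has_depth_def by auto
  with w ca_lr_zonohedron_eq[OF depth gap_pos[OF pos]] show ?attained
    by blast
next
  show ?bound
  proof
    fix w assume w: "w \<in> interior (lr_zonohedron n) \<inter> integer_lattice"
    obtain g where g: "has_depth n w g"
      using ex_has_depth[OF pos] by blast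
    have g0: "0 < g"
      using w g interior_lr_zonohedron_depth by blast
    have "g \<le> gap n"
      using w g lattice_depth_le_gap unfolding has_depth_def by blast
    then show "1 / gap n - 1 \<le> ca (lr_zonohedron n) w"
      unfolding ca_lr_zonohedron_eq[OF g g0] using g0 by (simp add: frac_le)
  qed
qed

theorem mainTheorem2:
  assumes d: "CARD('d::finite) \<ge> 2"
  shows "(\<forall>n::int ^ 'd. velocity_vector n \<longrightarrow>
            (\<exists>w \<in> interior (lr_zonohedron n) \<inter> integer_lattice.
               ca (lr_zonohedron n) w = 1 / gap n - 1) \<and>
            (\<forall>w \<in> interior (lr_zonohedron n) \<inter> integer_lattice.
               1 / gap n - 1 \<le> ca (lr_zonohedron n) w))
       \<and> ((\<forall>n::int ^ 'd. velocity_vector n \<longrightarrow> gap n \<ge> 1 / (real CARD('d) + 1))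
          \<longleftrightarrow>
          (\<forall>n::int ^ 'd. velocity_vector n \<longrightarrow>
            (\<exists>w \<in> interior (lr_zonohedron n) \<inter> integer_lattice.
               ca (lr_zonohedron n) w \<le> real CARD('d))))"
proof -
  have least: "(\<exists>w \<in> interior (lr_zonohedron n) \<inter> integer_lattice.
                  ca (lr_zonohedron n) w = 1 / gap n - 1) \<and>
               (\<forall>w \<in> interior (lr_zonohedron n) \<inter> integer_lattice.
                  1 / gap n - 1 \<le> ca (lr_zonohedron n) w)"
    if "velocity_vector n" for n :: "int ^ 'd"
    using that least_lattice_asymmetry[of n] by (auto simp: velocity_vector_def)
  moreover have "gap n \<ge> 1 / (real CARD('d) + 1) \<longleftrightarrow>
      (\<exists>w \<in> interior (lr_zonohedron n) \<inter> integer_lattice. ca (lr_zonohedron n) w \<le> real CARD('d))"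
    if n: "velocity_vector n" for n :: "int ^ 'd"
  proof -
    have "0 < gap n"
      using n by (intro gap_pos) (simp add: velocity_vector_def)
    then have "gap n \<ge> 1 / (real CARD('d) + 1) \<longleftrightarrow> 1 / gap n - 1 \<le> real CARD('d)"
      by (simp add: field_simps)
    then show ?thesis
      using least[OF n] by force
  qed
  ultimately show ?thesis
    by simp
qed

end
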